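(* Let $(v,w)\in M$ with $\mathrm{Im}(v/w)>0$. Then for all $k\in\mathbb Z$ (first two identities, $\lambda_{\mathrm B}\in\mathbb H_{\pm\mathcal L_k}$) and all integers $k\ge1$ (third identity, $\lambda_{\mathrm B}\in\mathbb H_{\pm\mathcal L_\infty}$), the functions $\Xi_{\pm\mathcal L_k}$ and $\Xi_{\pm\mathcal L_\infty,k}$ satisfy $$\frac{\Xi_{\pm\mathcal L_k}(v+\lambda_{\mathrm B},w,\lambda_{\mathrm B})}{\Xi_{\pm\mathcal L_k}(v,w,\lambda_{\mathrm B})}=\big(1-e^{\pm2\pi \mathrm i(v+kw)/\lambda_{\mathrm B}}\big)^{\pm1}=\big(1-\mathcal X_{\pm(\beta+k\delta)}\big)^{\pm\langle\beta^\vee,\beta+k\delta\rangle\Omega(\beta+k\delta)},$$ $$\frac{\Xi_{\pm\mathcal L_k}(v,w+\lambda_{\mathrm B},\lambda_{\mathrm B})}{\Xi_{\pm\mathcal L_k}(v,w,\lambda_{\mathrm B})}=\big(1-e^{\pm2\pi \mathrm i(v+kw)/\lambda_{\mathrm B}}\big)^{\pm k}=\big(1-\mathcal X_{\pm(\beta+k\delta)}\big)^{\pm\langle\delta^\vee,\beta+k\delta\rangle\Omega(\beta+k\delta)},$$ $$\frac{\Xi_{\pm\mathcal L_\infty,k}(0,w+\lambda_{\mathrm B},\lambda_{\mathrm B})}{\Xi_{\pm\mathcal L_\infty,k}(0,w,\lambda_{\mathrm B})}=\big(1-e^{\pm2\pi \mathrm i kw/\lambda_{\mathrm B}}\big)^{\mp2k}=\big(1-\mathcal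 X_{\pm k\delta}\big)^{\pm\langle\delta^\vee,k\delta\rangle\Omega(k\delta)}.$$
   Context: $M=\{(v,w)\in\mathbb C^2: w\ne0,\ v+nw\ne0\ \forall n\in\mathbb Z\}$. Lattice $\Gamma=\mathbb Z\delta\oplus\mathbb Z\beta\oplus\mathbb Z\delta^\vee\oplus\mathbb Z\beta^\vee$ with skew pairing $\langle\delta^\vee,\delta\rangle=\langle\beta^\vee,\beta\rangle=1$, all other pairings of basis elements (up to skew-symmetry) zero. BPS indices: $\Omega(\pm\beta+n\delta)=1$ for $n\in\mathbb Z$, $\Omega(k\delta)=-2$ for $k\in\mathbb Z\setminus\{0\}$, $\Omega=0$ otherwise. $\mathcal X_{n\beta+m\delta}=e^{2\pi \mathrm i(nv+mw)/\lambda_{\mathrm B}}$. Rays: $\mathcal L_k=\mathbb R_{<0}\cdot2\pi \mathrm i(v+kw)$, $\mathcal L_\infty=\mathbb R_{<0}\cdot2\pi \mathrm i w$; $\mathbb H_\rho$ is the open half-plane centered at the ray $\rho$. Functions: $$\Xi_{\pm\mathcal L_k}(v,w,\lambda_{\mathrm B})=\exp\Big(\tfrac{1}{2\pi \mathrm i}\partial_{\lambda_{\mathrm B}}\big(\lambda_{\mathrm B}\mathrm{Li}_2(e^{\pm2\pi \mathrm i(v+kw)/\lambda_{\mathrm B}})\big)\Big),\quad \Xi_{\pm\mathcal L_\infty,k}(v,w,\lambda_{\mathrm B})=\exp\Big(-\tfrac{1}{\pi \mathrm i}\partial_{\lambda_{\mathrm B}}\big(\lambda_{\mathrm B}\mathrm{Li}_2(e^{\pm2\pi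 \mathrm i kw/\lambda_{\mathrm B}})\big)\Big),$$ where in the derivative $v,w$ are held fixed, and the expressions are evaluated where the exponential argument of $\mathrm{Li}_2(z)=\sum_{n\ge1} z^n/n^2$ has modulus less than $1$ (which is the case for $\lambda_{\mathrm B}$ in the stated half-planes, also after the shifts of $v$ or $w$ by $\lambda_{\mathrm B}$). $\Xi_{\pm\mathcal L_\infty,k}$ does not depend on $v$. These functions are the exponentiated Stokes jumps of the normalized topological string partition function of the resolved conifold; the right-hand sides are the jump factors of Bridgeland's Riemann--Hilbert problem. *)

theory Defs
  imports "HOL-Analysis.Analysis" "HOL-Library.Poly_Mapping"
begin

definition M :: "(complex \<times> complex) set" where
  "M = {(v, w). w \<noteq> 0 \<and> (\<forall>n::int. v + of_int n * w \<noteq> 0)}"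

text \<open>The charge lattice is the free abelian group on the four symbols below.\<close>

datatype charge_basis = CDelta | CBeta | CDelta_dual | CBeta_dual

type_synonym charge = "charge_basis \<Rightarrow>\<^sub>0 int"

abbreviation \<delta> :: charge where "\<delta> \<equiv> frag_of CDelta"
abbreviation \<beta> :: charge where "\<beta> \<equiv> frag_of CBeta"
abbreviation \<delta>_dual :: charge where "\<delta>_dual \<equiv> frag_of CDelta_dual"
abbreviation \<beta>_dual :: charge where "\<beta>_dual \<equiv> frag_of CBeta_dual"

abbreviation coord :: "charge \<Rightarrow> charge_basis \<Rightarrow> int" where
  "coord \<equiv> Poly_Mapping.lookup"

definition pairing :: "charge \<Rightarrow> charge \<Rightarrow> int" where
  "pairing a b =
     coord a CDelta_dual * coord b CDelta - coord a CDelta * coord b CDelta_dual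
   + coord a CBeta_dual * coord b CBeta - coord a CBeta * coord b CBeta_dual"

definition BPS :: "charge \<Rightarrow> int" where
  "BPS \<gamma> =
    (if \<exists>n::int. \<gamma> = \<beta> + frag_cmul n \<delta> \<or> \<gamma> = - \<beta> + frag_cmul n \<delta> then 1
     else if \<exists>k::int. k \<noteq> 0 \<and> \<gamma> = frag_cmul k \<delta> then -2
     else 0)"

text \<open>Only meaningful for charges in the span of \<open>\<beta>\<close> and \<open>\<delta>\<close>; the components of
  \<open>\<gamma>\<close> along the dual generators are ignored.\<close>

definition char_X :: "charge \<Rightarrow> complex \<Rightarrow> complex \<Rightarrow> complex \<Rightarrow> complex" where
  "char_X \<gamma> v w lam =
     exp (2 * of_real pi * \<i> * (of_int (coord \<gamma> CBeta) * v + of_int (coord \<gamma> CDelta) * w) / lam)"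

definition neg_ray :: "complex \<Rightarrow> complex set" where
  "neg_ray z = {of_real t * z | t::real. t < 0}"

definition ray_L :: "int \<Rightarrow> complex \<Rightarrow> complex \<Rightarrow> complex set" where
  "ray_L k v w = neg_ray (2 * of_real pi * \<i> * (v + of_int k * w))"

definition ray_Linf :: "complex \<Rightarrow> complex set" where
  "ray_Linf w = neg_ray (2 * of_real pi * \<i> * w)"

text \<open>The ray \<open>\<plusminus>\<rho>\<close>, where the sign is given as an integer \<open>s \<in> {1, -1}\<close>; the same
  encoding of signs is used in the functions below.\<close>

definition signed_ray :: "int \<Rightarrow> complex set \<Rightarrow> complex set" where
  "signed_ray s \<rho> = (\<lambda>z. of_int s * z) ` \<rho>"

definition half_plane :: "complex set \<Rightarrow> complex set" where
  "half_plane \<rho> = {z. \<forall>r\<in>\<rho>. z \<bullet> r > 0}"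

text \<open>The power series; only used for \<open>norm z < 1\<close>.\<close>

definition Li2 :: "complex \<Rightarrow> complex" where
  "Li2 z = suminf (\<lambda>n. z ^ Suc n / of_nat (Suc n) ^ 2)"

text \<open>The derivative is taken with \<open>v\<close> and \<open>w\<close> held fixed, also when these functions are
  later evaluated at \<open>v + lam\<close> or \<open>w + lam\<close>.\<close>

definition Xi :: "int \<Rightarrow> int \<Rightarrow> complex \<Rightarrow> complex \<Rightarrow> complex \<Rightarrow> complex" where
  "Xi s k v w lam = exp (1 / (2 * of_real pi * \<i>) *
     deriv (\<lambda>l. l * Li2 (exp (of_int s * (2 * of_real pi * \<i> * (v + of_int k * w)) / l))) lam)"

definition Xi_inf :: "int \<Rightarrow> int \<Rightarrow> complex \<Rightarrow> complex \<Rightarrow> complex \<Rightarrow> complex" where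
  "Xi_inf s k v w lam = exp (- (1 / (of_real pi * \<i>)) *
     deriv (\<lambda>l. l * Li2 (exp (of_int s * (2 * of_real pi * \<i> * of_int k * w) / l))) lam)"

end

theory Submission
  imports Defs
begin

text \<open>Since \<open>z Li2'(z) = - ln (1 - z)\<close>, the derivative of \<open>l \<mapsto> l Li2 (exp (a / l))\<close> is
  \<open>Li2 q + (a / l) ln (1 - q)\<close> with \<open>q = exp (a / l)\<close>. Shifting \<open>v\<close> or \<open>w\<close> by \<open>l\<close>
  replaces \<open>a\<close> by \<open>a + 2\<pi>i m l\<close> for an integer \<open>m\<close>; this leaves \<open>q\<close> unchanged, so the
  derivative changes by \<open>2\<pi>i m ln (1 - q)\<close> and its exponential by a power of \<open>1 - q\<close>.\<close>

lemma summable_Li2_coeffs: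
  fixes z :: complex
  assumes "norm z < 1"
  shows "summable (\<lambda>n. 1 / of_nat n ^ 2 * z ^ n)"
proof (rule summable_comparison_test')
  show "summable (\<lambda>n. norm z ^ n)"
    using assms by (intro summable_geometric) auto
  fix n :: nat
  have "norm (1 / of_nat n ^ 2 :: complex) \<le> 1"
    by (cases "n = 0") (auto simp: norm_divide norm_power)
  thus "norm (1 / of_nat n ^ 2 * z ^ n) \<le> norm z ^ n"
    unfolding norm_mult norm_power by (intro mult_left_le_one_le) auto
qed

text \<open>The zeroth coefficient is \<open>1 / 0 = 0\<close>.\<close>

lemma Li2_eq_suminf:
  assumes "norm z < 1"
  shows "Li2 z = suminf (\<lambda>n. 1 / of_nat n ^ 2 * z ^ n)"
  using suminf_split_head[OF summable_Li2_coeffs[OF assms]]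
  by (simp add: Li2_def)

text \<open>This is the series of \<open>- ln (1 - z)\<close> with one factor \<open>z\<close> taken
  out. The factor stays on the left because the bare sum will be the derivative of
  \<open>Li2\<close>, also at \<open>z = 0\<close>, where dividing by \<open>z\<close> would
  fail.\<close>

lemma suminf_power_div_Suc:
  fixes z :: complex
  assumes "norm z < 1"
  shows "z * suminf (\<lambda>n. z ^ n / of_nat (Suc n)) = - ln (1 - z)"
proof -
  have "(\<lambda>n. - ((- 1) ^ Suc n / of_nat n * (- z) ^ n)) sums (- ln (1 + (- z)))"
    by (intro sums_minus Ln_series) (use assms in simp)
  also have "(\<lambda>n. - ((- 1) ^ Suc n / of_nat n * (- z) ^ n)) = (\<lambda>n. z ^ n / of_nat n)"
  proof
    fix n
    show "- ((- 1) ^ Suc n / of_nat n * (- z) ^ n) = z ^ n / of_nat n"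
      by (cases "even n") auto
  qed
  finally have "(\<lambda>n. z ^ n / of_nat n) sums (- ln (1 - z))"
    by simp
  \<comment> \<open>The index shift drops only the term at \<open>n = 0\<close>, which is
    \<open>1 / 0 = 0\<close>.\<close>
  hence sums: "(\<lambda>n. z * (z ^ n / of_nat (Suc n))) sums (- ln (1 - z))"
    using sums_Suc_iff[of "\<lambda>n. z ^ n / of_nat n" "- ln (1 - z)"] by simp
  show ?thesis
  proof (cases "z = 0")
    \<comment> \<open>Cancelling \<open>z\<close> to obtain summability needs
      \<open>z \<noteq> 0\<close>; at \<open>z = 0\<close> both sides vanish.\<close>
    case False
    with sums have "summable (\<lambda>n. z ^ n / of_nat (Suc n))"
      using summable_mult_D[OF sums_summable[OF sums]] by blast
    from suminf_mult[OF this, of z] sums_unique[OF sums] show ?thesis by simp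
  qed simp
qed

lemma has_field_derivative_Li2:
  assumes "norm z < 1"
  shows "(Li2 has_field_derivative (suminf (\<lambda>n. z ^ n / of_nat (Suc n)))) (at z)"
proof -
  have "((\<lambda>z. suminf (\<lambda>n. 1 / of_nat n ^ 2 * z ^ n)) has_field_derivative
          suminf (\<lambda>n. diffs (\<lambda>n. 1 / of_nat n ^ 2) n * z ^ n)) (at z)"
    by (rule termdiffs_strong'[where K = 1]) (use assms summable_Li2_coeffs in auto)
  moreover have "diffs (\<lambda>n. 1 / of_nat n ^ 2) n * z ^ n = z ^ n / of_nat (Suc n)" for n
    by (simp add: diffs_def power2_eq_square del: of_nat_Suc)
  ultimately have "((\<lambda>z. suminf (\<lambda>n. 1 / of_nat n ^ 2 * z ^ n)) has_field_derivative
          suminf (\<lambda>n. z ^ n / of_nat (Suc n))) (at z)"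
    by simp
  \<comment> \<open>\<open>Li2\<close> is identified with the power series on the unit disc; as the
    disc is open, the derivative at \<open>z\<close> carries over.\<close>
  thus ?thesis
    by (rule has_field_derivative_transform_within_open[where S = "ball 0 1"])
       (use assms in \<open>auto simp: Li2_eq_suminf\<close>)
qed

lemma deriv_scaled_Li2:
  fixes a l :: complex
  assumes "l \<noteq> 0" and "norm (exp (a / l)) < 1"
  shows "deriv (\<lambda>l. l * Li2 (exp (a / l))) l
           = Li2 (exp (a / l)) + a / l * ln (1 - exp (a / l))"
proof (rule DERIV_imp_deriv)
  define q where "q = exp (a / l)"
  define D where "D = suminf (\<lambda>n. q ^ n / of_nat (Suc n))"
  have q: "norm q < 1" using assms by (simp add: q_def)
  have "((\<lambda>l. exp (a / l)) has_field_derivative (- (a / l ^ 2) * q)) (at l)"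
    unfolding q_def using assms
    by (auto intro!: derivative_eq_intros simp: power2_eq_square)
  from DERIV_chain2[OF has_field_derivative_Li2[OF q, unfolded q_def] this]
  have "((\<lambda>l. Li2 (exp (a / l))) has_field_derivative D * (- (a / l ^ 2) * q)) (at l)"
    by (simp add: D_def q_def)
  from DERIV_mult[OF DERIV_ident this]
  have "((\<lambda>l. l * Li2 (exp (a / l))) has_field_derivative
          Li2 q + l * (D * (- (a / l ^ 2) * q))) (at l)"
    by (simp add: q_def algebra_simps)
  \<comment> \<open>The inner derivative and the outer factor \<open>l\<close> combine to
    \<open>- (a / l)\<close>, which leaves \<open>q * D\<close>, the logarithm series.\<close>
  also have "l * (D * (- (a / l ^ 2) * q)) = - (a / l) * (q * D)"
    using assms by (simp add: field_simps power2_eq_square)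
  also have "\<dots> = a / l * ln (1 - q)"
    using suminf_power_div_Suc[OF q] by (simp add: D_def)
  finally show "((\<lambda>l. l * Li2 (exp (a / l))) has_field_derivative
          Li2 (exp (a / l)) + a / l * ln (1 - exp (a / l))) (at l)"
    by (simp add: q_def)
qed

text \<open>The numerator moves by a multiple of the fixed point \<open>l\<close>, not of the
  variable \<open>t\<close>: the derivative is formed first, and the shifted argument is inserted as
  a constant.\<close>

lemma deriv_scaled_Li2_shift:
  fixes a l :: complex and m :: int
  assumes "l \<noteq> 0" and "norm (exp (a / l)) < 1"
  shows "deriv (\<lambda>t. t * Li2 (exp ((a + of_int m * (2 * of_real pi * \<i>) * l) / t))) l
           = deriv (\<lambda>t. t * Li2 (exp (a / t))) l
             + of_int m * (2 * of_real pi * \<i>) * ln (1 - exp (a / l))"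
proof -
  have eq: "(a + of_int m * (2 * of_real pi * \<i>) * l) / l
              = a / l + of_int m * (2 * of_real pi * \<i>)"
    using assms by (simp add: field_simps)
  have "exp (of_int m * (2 * of_real pi * \<i>)) = 1"
    using exp_integer_2pi[of "of_int m"] by (simp add: mult_ac)
  hence "exp ((a + of_int m * (2 * of_real pi * \<i>) * l) / l) = exp (a / l)"
    unfolding eq exp_add by simp
  thus ?thesis
    using assms by (simp add: deriv_scaled_Li2 eq distrib_right)
qed

text \<open>With an integer factor the choice of the branch of \<open>ln\<close> has no effect after
  exponentiation.\<close>

lemma exp_int_mult_ln:
  fixes z :: complex
  assumes "z \<noteq> 0"
  shows "exp (of_int m * ln z) = z powi m"
  using assms exp_power_int[of "ln z" m] by simp

text \<open>The real part of \<open>of_int s * z / l\<close> has the sign of the inner product of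
  \<open>l\<close> with \<open>of_int s * z\<close>, and the ray points in the direction opposite to
  \<open>of_int s * z\<close>. Testing the ray at \<open>t = - 1\<close> is enough.\<close>

lemma half_plane_signed_neg_ray:
  assumes "l \<in> half_plane (signed_ray s (neg_ray z))"
  shows "l \<noteq> 0" and "norm (exp (of_int s * z / l)) < 1"
proof -
  have "of_int s * (of_real (- 1) * z) \<in> signed_ray s (neg_ray z)"
    unfolding signed_ray_def neg_ray_def by (intro imageI CollectI exI[of _ "- 1"]) simp
  hence inner: "l \<bullet> (of_int s * z) < 0"
    using assms by (force simp: half_plane_def)
  thus "l \<noteq> 0" by auto
  have "Re (of_int s * z / l) = l \<bullet> (of_int s * z) / (norm l)\<^sup>2"
    by (simp add: Re_divide inner_complex_def cmod_power2 algebra_simps)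
  also have "\<dots> < 0"
    using inner \<open>l \<noteq> 0\<close> by (simp add: divide_neg_pos)
  finally show "norm (exp (of_int s * z / l)) < 1"
    by simp
qed

text \<open>The ray at infinity does not involve \<open>k\<close>; a positive factor keeps the real
  part negative, so one half-plane serves every \<open>Xi_inf s k\<close>.\<close>

lemma norm_exp_int_mult_less_1:
  fixes z :: complex and k :: int
  assumes "norm (exp z) < 1" and "k \<ge> 1"
  shows "norm (exp (of_int k * z)) < 1"
  using assms by (simp add: mult_pos_neg)

text \<open>Covers both shifts: \<open>m = 1\<close> when \<open>v\<close> moves and
  \<open>m = k\<close> when \<open>w\<close> moves. The prefactor of \<open>Xi\<close> cancels the
  \<open>2 pi i\<close> of the jump, and \<open>s\<close> enters the exponent through the
  numerator.\<close>

lemma Xi_shift: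
  assumes "l \<noteq> 0" and "norm (exp (of_int s * (2 * of_real pi * \<i> * (v + of_int k * w)) / l)) < 1"
    and "v' + of_int k * w' = v + of_int k * w + of_int m * l"
  shows "Xi s k v' w' l / Xi s k v w l
           = (1 - exp (of_int s * (2 * of_real pi * \<i> * (v + of_int k * w)) / l)) powi (s * m)"
proof -
  define a where "a = of_int s * (2 * of_real pi * \<i> * (v + of_int k * w))"
  have a': "of_int s * (2 * of_real pi * \<i> * (v' + of_int k * w'))
             = a + of_int (s * m) * (2 * of_real pi * \<i>) * l"
    unfolding assms(3) a_def by (simp add: algebra_simps)
  have q: "norm (exp (a / l)) < 1" using assms by (simp add: a_def)
  hence "1 - exp (a / l) \<noteq> 0" by (metis diff_eq_eq add_0 less_irrefl norm_one)
  note pw = exp_int_mult_ln[OF this, of "s * m"]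
  show ?thesis
    unfolding Xi_def a' a_def[symmetric] deriv_scaled_Li2_shift[OF assms(1) q] exp_diff[symmetric]
      pw[symmetric]
    by (simp add: field_simps)
qed

text \<open>The prefactor is \<open>- 2\<close> times that of \<open>Xi\<close>, so the shift number
  \<open>s * k\<close> yields the exponent \<open>- 2 * s * k\<close>.\<close>

lemma Xi_inf_shift:
  assumes "l \<noteq> 0" and "norm (exp (of_int s * (2 * of_real pi * \<i> * of_int k * w) / l)) < 1"
  shows "Xi_inf s k v (w + l) l / Xi_inf s k v w l
           = (1 - exp (of_int s * (2 * of_real pi * \<i> * of_int k * w) / l)) powi (- s * (2 * k))"
proof -
  define a where "a = of_int s * (2 * of_real pi * \<i> * of_int k * w)"
  have a': "of_int s * (2 * of_real pi * \<i> * of_int k * (w + l))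
             = a + of_int (s * k) * (2 * of_real pi * \<i>) * l"
    unfolding a_def by (simp add: algebra_simps)
  have q: "norm (exp (a / l)) < 1" using assms by (simp add: a_def)
  hence "1 - exp (a / l) \<noteq> 0" by (metis diff_eq_eq add_0 less_irrefl norm_one)
  note pw = exp_int_mult_ln[OF this, of "- s * (2 * k)"]
  show ?thesis
    unfolding Xi_inf_def a' a_def[symmetric] deriv_scaled_Li2_shift[OF assms(1) q]
      exp_diff[symmetric] pw[symmetric]
    by (simp add: field_simps)
qed

lemma BPS_beta_delta: "BPS (\<beta> + frag_cmul k \<delta>) = 1"
  by (auto simp: BPS_def)

lemma BPS_delta:
  assumes "k \<noteq> 0"
  shows "BPS (frag_cmul k \<delta>) = - 2"
proof -
  have "frag_cmul k \<delta> \<noteq> \<beta> + frag_cmul n \<delta> \<and> frag_cmul k \<delta> \<noteq> - \<beta> + frag_cmul n \<delta>" for n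
    \<comment> \<open>The coordinate along \<open>\<beta>\<close> is \<open>0\<close> on one side
      and \<open>1\<close> or \<open>- 1\<close> on the other.\<close>
    by (auto dest!: arg_cong[of _ _ "\<lambda>c. coord c CBeta"] simp: lookup_add lookup_minus)
  thus ?thesis using assms by (auto simp: BPS_def)
qed

lemma pairing_dual:
  "pairing \<beta>_dual \<gamma> = coord \<gamma> CBeta" "pairing \<delta>_dual \<gamma> = coord \<gamma> CDelta"
  by (simp_all add: pairing_def)

lemma char_X_beta_delta:
  "char_X (frag_cmul s (\<beta> + frag_cmul k \<delta>)) v w l
     = exp (of_int s * (2 * of_real pi * \<i> * (v + of_int k * w)) / l)"
  by (simp add: char_X_def lookup_add algebra_simps)

lemma char_X_delta:
  "char_X (frag_cmul s (frag_cmul k \<delta>)) v w l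
     = exp (of_int s * (2 * of_real pi * \<i> * of_int k * w) / l)"
  by (simp add: char_X_def algebra_simps)

theorem corollary4p13:
  fixes v w :: complex
  assumes "(v, w) \<in> M" and "Im (v / w) > 0"
  shows "(\<forall>s\<in>{1, -1::int}. \<forall>k::int. \<forall>lam\<in>half_plane (signed_ray s (ray_L k v w)).
            Xi s k (v + lam) w lam / Xi s k v w lam
              = (1 - exp (of_int s * (2 * of_real pi * \<i> * (v + of_int k * w)) / lam)) powi s
          \<and> (1 - exp (of_int s * (2 * of_real pi * \<i> * (v + of_int k * w)) / lam)) powi s
              = (1 - char_X (frag_cmul s (\<beta> + frag_cmul k \<delta>)) v w lam)
                  powi (s * (pairing \<beta>_dual (\<beta> + frag_cmul k \<delta>) * BPS (\<beta> + frag_cmul k \<delta>))))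
       \<and> (\<forall>s\<in>{1, -1::int}. \<forall>k::int. \<forall>lam\<in>half_plane (signed_ray s (ray_L k v w)).
            Xi s k v (w + lam) lam / Xi s k v w lam
              = (1 - exp (of_int s * (2 * of_real pi * \<i> * (v + of_int k * w)) / lam)) powi (s * k)
          \<and> (1 - exp (of_int s * (2 * of_real pi * \<i> * (v + of_int k * w)) / lam)) powi (s * k)
              = (1 - char_X (frag_cmul s (\<beta> + frag_cmul k \<delta>)) v w lam)
                  powi (s * (pairing \<delta>_dual (\<beta> + frag_cmul k \<delta>) * BPS (\<beta> + frag_cmul k \<delta>))))
       \<and> (\<forall>s\<in>{1, -1::int}. \<forall>k::int. k \<ge> 1 \<longrightarrow>
           (\<forall>lam\<in>half_plane (signed_ray s (ray_Linf w)).
            Xi_inf s k 0 (w + lam) lam / Xi_inf s k 0 w lam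
              = (1 - exp (of_int s * (2 * of_real pi * \<i> * of_int k * w) / lam)) powi (- s * (2 * k))
          \<and> (1 - exp (of_int s * (2 * of_real pi * \<i> * of_int k * w) / lam)) powi (- s * (2 * k))
              = (1 - char_X (frag_cmul s (frag_cmul k \<delta>)) v w lam)
                  powi (s * (pairing \<delta>_dual (frag_cmul k \<delta>) * BPS (frag_cmul k \<delta>)))))"
proof (intro conjI ballI allI impI)
  fix s k :: int and lam :: complex
  assume "lam \<in> half_plane (signed_ray s (ray_L k v w))"
  note half_plane_signed_neg_ray[OF this[unfolded ray_L_def]]
  note Xi_shift = Xi_shift[OF this]
  show "Xi s k (v + lam) w lam / Xi s k v w lam
          = (1 - exp (of_int s * (2 * of_real pi * \<i> * (v + of_int k * w)) / lam)) powi s"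
    using Xi_shift[of "v + lam" w 1] by simp
  show "Xi s k v (w + lam) lam / Xi s k v w lam
          = (1 - exp (of_int s * (2 * of_real pi * \<i> * (v + of_int k * w)) / lam)) powi (s * k)"
    using Xi_shift[of v "w + lam" k] by (simp add: algebra_simps)
next
  fix s k :: int and lam :: complex
  assume k: "k \<ge> 1" and "lam \<in> half_plane (signed_ray s (ray_Linf w))"
  note * = half_plane_signed_neg_ray[OF this(2)[unfolded ray_Linf_def]]
  have "norm (exp (of_int s * (2 * of_real pi * \<i> * of_int k * w) / lam)) < 1"
    using norm_exp_int_mult_less_1[OF *(2) k] by (simp add: mult_ac)
  thus "Xi_inf s k 0 (w + lam) lam / Xi_inf s k 0 w lam
          = (1 - exp (of_int s * (2 * of_real pi * \<i> * of_int k * w) / lam)) powi (- s * (2 * k))"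
    by (rule Xi_inf_shift[OF *(1)])
  show "(1 - exp (of_int s * (2 * of_real pi * \<i> * of_int k * w) / lam)) powi (- s * (2 * k))
          = (1 - char_X (frag_cmul s (frag_cmul k \<delta>)) v w lam)
              powi (s * (pairing \<delta>_dual (frag_cmul k \<delta>) * BPS (frag_cmul k \<delta>)))"
    \<comment> \<open>\<open>k \<ge> 1\<close> excludes the zero charge, whose index is
      \<open>0\<close>; otherwise the coordinate \<open>k\<close> times the index \<open>- 2\<close>
      gives the exponent.\<close>
    unfolding char_X_delta using k by (simp add: pairing_dual BPS_delta mult_ac)
\<comment> \<open>What remains are the lattice forms of the first two identities: the coordinates of
  \<open>\<beta> + frag_cmul k \<delta>\<close> are \<open>1\<close> and \<open>k\<close>, and its
  index is \<open>1\<close>.\<close>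
qed (simp_all add: char_X_beta_delta pairing_dual BPS_beta_delta lookup_add)

end
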